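(* Let $\overline{\mathrm{Q}}$ be an imprecise probability tree. Consider any $\overline{\mathrm{E}}\in\overline{\mathbb{E}}_{1-5}(\overline{\mathrm{Q}})$ that satisfies P3$^{=}$, P6 and P7. Then, for all $\overline{\mathrm{E}}'\in\overline{\mathbb{E}}_{1-5}(\overline{\mathrm{Q}})$, we have that $$\overline{\mathrm{E}}(f\vert s)\geq\overline{\mathrm{E}}'(f\vert s)\quad\text{for all } f\in\overline{\mathbb{V}}\text{ and all } s\in\mathscr{X}^*.$$
   Context: Conventions: $\mathbb{N}=\{1,2,\dots\}$, $\mathbb{N}_0=\mathbb{N}\cup\{0\}$, $\overline{\mathbb{R}}=\mathbb{R}\cup\{-\infty,+\infty\}$, with $+\infty-\infty=-\infty+\infty=+\infty$ and $0\cdot(+\infty)=0\cdot(-\infty)=0$; $\inf\emptyset=+\infty$. Inequalities between functions and limits of functions are pointwise. Setting: $\mathscr{X}$ is a finite non-empty set (state space). A situation is a finite string $x_{1:n}=(x_1,\dots,x_n)\in\mathscr{X}^n$, $n\in\mathbb{N}_0$ (the empty string is denoted $\Box$); $\mathscr{X}^*$ is the set of all situations. $\Omega=\mathscr{X}^{\mathbb{N}}$ is the set of paths $\omega=\omega_1\omega_2\cdots$, and $\omega^n=(\omega_1,\dots,\omega_n)$. For $s=x_{1:n}$, $\Gamma(s)=\{\omega\in\Omega:\omega^n=x_{1:n}\}$ and $\mathbb{I}_s$ is the indicator of $\Gamma(s)$. $\overline{\mathbb{V}}$ is the set of all maps $\Omega\to\overline{\mathbb{R}}$ (global variables) and $\overline{\mathbb{V}}_{\mathrm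 b}$ the set of those that are bounded below by a real. A gamble is a bounded real-valued function. $f\in\overline{\mathbb{V}}$ is $n$-measurable if $f(\omega)$ depends only on $\omega^n$; it is finitary if it is $n$-measurable for some $n\in\mathbb{N}_0$. $\mathbb{V}_{\mathrm{fin}}$ is the set of finitary gambles on $\Omega$. $\overline{\mathbb{V}}_{\mathrm{b,lim}}$ is the set of all $f\in\overline{\mathbb{V}}_{\mathrm b}$ that are the pointwise limit of some sequence in $\mathbb{V}_{\mathrm{fin}}$. A sequence $\{f_n\}$ is uniformly bounded below if there is a real $c$ with $f_n\geq c$ for all $n$. $\mathscr{L}(\mathscr{X})$ is the set of all real-valued functions on $\mathscr{X}$; for $f\in\mathscr{L}(\mathscr{X})$, $f(X_{n+1})$ is the global variable $\omega\mapsto f(\omega_{n+1})$. Local models: an upper expectation $\overline{\mathrm{Q}}_s:\mathscr{L}(\mathscr{X})\to\overline{\mathbb{R}}$ is coherent if, for all $f,g\in\mathscr{L}(\mathscr{X})$ and real $\lambda\geq0$: $\overline{\mathrm{Q}}_s(f)\leq\sup f$; $\overline{\mathrm{Q}}_s(f+g)\leq\overline{\mathrm{Q}}_s(f)+\overline{\mathrm{Q}}_s(g)$; $\overline{\mathrm{Q}}_s(\lambda f)=\lambda\overline{\mathrm{Q}}_s(f)$ (it is then real-valued). An imprecise probability tree $\overline{\mathrm{Q}}$ assigns to each $s\in\mathscr{X}^*$ a coherent upper expectation $\overline{\mathrm{Q}}_s$ on $\mathscr{L}(\mathscr{X})$. A global upper expectation is any map $\overline{\mathrm{E}}:\overline{\mathbb{V}}\times\mathscr{X}^*\to\overline{\mathbb{R}}$,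 $(f,s)\mapsto\overline{\mathrm{E}}(f\vert s)$; $\overline{\mathrm{E}}(f\vert X_{1:n})$ denotes the global variable $\omega\mapsto\overline{\mathrm{E}}(f\vert\omega^n)$. Axioms: P1: $\overline{\mathrm{E}}(f(X_{n+1})\vert x_{1:n})=\overline{\mathrm{Q}}_{x_{1:n}}(f)$ for all $f\in\mathscr{L}(\mathscr{X})$, $x_{1:n}\in\mathscr{X}^*$. P2: $\overline{\mathrm{E}}(f\vert s)=\overline{\mathrm{E}}(f\,\mathbb{I}_s\vert s)$ for all $f\in\mathbb{V}_{\mathrm{fin}}$, $s\in\mathscr{X}^*$. P3: $\overline{\mathrm{E}}(f\vert X_{1:n})\leq\overline{\mathrm{E}}(\overline{\mathrm{E}}(f\vert X_{1:n+1})\vert X_{1:n})$ for all $f\in\mathbb{V}_{\mathrm{fin}}$, $n\in\mathbb{N}_0$. P4: $f\leq g\Rightarrow\overline{\mathrm{E}}(f\vert s)\leq\overline{\mathrm{E}}(g\vert s)$ for all $f,g\in\overline{\mathbb{V}}$, $s\in\mathscr{X}^*$. P5: for any sequence $\{f_n\}_{n\in\mathbb{N}_0}$ of finitary gambles that is uniformly bounded below and any $s\in\mathscr{X}^*$, if $\lim_{n}f_n=f$ pointwise then $\limsup_{n}\overline{\mathrm{E}}(f_n\vert s)\geq\overline{\mathrm{E}}(f\vert s)$. $\overline{\mathbb{E}}_{1-5}(\overline{\mathrm{Q}})$ is the set of all global upper expectations satisfying P1–P5. P3$^{=}$: $\overline{\mathrm{E}}(f\vert X_{1:n})=\overline{\mathrm{E}}(\overline{\mathrm{E}}(f\vert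 X_{1:n+1})\vert X_{1:n})$ for all $f\in\mathbb{V}_{\mathrm{fin}}$, $n\in\mathbb{N}_0$. P6: for any $f\in\overline{\mathbb{V}}_{\mathrm{b,lim}}$ and $s\in\mathscr{X}^*$ there is a sequence $\{f_n\}_{n\in\mathbb{N}_0}$ of gambles, with each $f_n$ $n$-measurable, that is uniformly bounded below, converges pointwise to $f$, and satisfies $\limsup_n\overline{\mathrm{E}}(f_n\vert s)\leq\overline{\mathrm{E}}(f\vert s)$. P7: $\overline{\mathrm{E}}(f\vert s)=\inf\{\overline{\mathrm{E}}(g\vert s):g\in\overline{\mathbb{V}}_{\mathrm{b,lim}},\ g\geq f\}$ for all $f\in\overline{\mathbb{V}}$, $s\in\mathscr{X}^*$. *)

theory Defs
  imports "HOL-Library.Extended_Real" "HOL-Library.Liminf_Limsup" "HOL-Library.Indicator_Function"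
begin

text \<open>
  The finite non-empty state space is a type of class finite.  Paths are indexed from 0, so the
  state written \<open>\<omega>\<^sub>k\<close> for \<open>k = 1, 2, \<dots>\<close> is \<open>\<omega> (k - 1)\<close> here.  In particular \<open>X\<^sub>n\<^sub>+\<^sub>1\<close> is \<open>\<lambda>\<omega>. \<omega> n\<close>.

  Arithmetic on \<open>ereal\<close> follows the intended conventions: \<open>\<infinity> + (-\<infinity>) = \<infinity>\<close>, \<open>0 * (\<plusminus>\<infinity>) = 0\<close>
  and \<open>Inf {} = \<infinity>\<close>.
\<close>

type_synonym 'x situation = "'x list"
type_synonym 'x path = "nat \<Rightarrow> 'x"
type_synonym 'x global_var = "'x path \<Rightarrow> ereal"
type_synonym 'x tree = "'x situation \<Rightarrow> ('x \<Rightarrow> real) \<Rightarrow> ereal"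
type_synonym 'x global_upper_exp = "'x global_var \<Rightarrow> 'x situation \<Rightarrow> ereal"

definition path_prefix :: "'x path \<Rightarrow> nat \<Rightarrow> 'x situation" where
  "path_prefix \<omega> n = map \<omega> [0..<n]"

definition cylinder :: "'x situation \<Rightarrow> 'x path set" where
  "cylinder s = {\<omega>. path_prefix \<omega> (length s) = s}"

definition bounded_below :: "'x global_var \<Rightarrow> bool" where
  "bounded_below f \<longleftrightarrow> (\<exists>c::real. \<forall>\<omega>. ereal c \<le> f \<omega>)"

definition gamble :: "'x global_var \<Rightarrow> bool" where
  "gamble f \<longleftrightarrow> (\<exists>c::real. \<forall>\<omega>. \<bar>f \<omega>\<bar> \<le> ereal c)"

definition n_measurable :: "nat \<Rightarrow> 'x global_var \<Rightarrow> bool" where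
  "n_measurable n f \<longleftrightarrow> (\<forall>\<omega> \<omega>'. path_prefix \<omega> n = path_prefix \<omega>' n \<longrightarrow> f \<omega> = f \<omega>')"

definition finitary :: "'x global_var \<Rightarrow> bool" where
  "finitary f \<longleftrightarrow> (\<exists>n. n_measurable n f)"

definition V_fin :: "'x global_var set" where
  "V_fin = {f. gamble f \<and> finitary f}"

definition ptwise_lim :: "(nat \<Rightarrow> 'x global_var) \<Rightarrow> 'x global_var \<Rightarrow> bool" where
  "ptwise_lim fs f \<longleftrightarrow> (\<forall>\<omega>. (\<lambda>n. fs n \<omega>) \<longlonglongrightarrow> f \<omega>)"

definition unif_bounded_below :: "(nat \<Rightarrow> 'x global_var) \<Rightarrow> bool" where
  "unif_bounded_below fs \<longleftrightarrow> (\<exists>c::real. \<forall>n \<omega>. ereal c \<le> fs n \<omega>)"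

definition V_blim :: "'x global_var set" where
  "V_blim = {f. bounded_below f \<and> (\<exists>fs. (\<forall>n. fs n \<in> V_fin) \<and> ptwise_lim fs f)}"

definition coherent :: "(('x::finite \<Rightarrow> real) \<Rightarrow> ereal) \<Rightarrow> bool" where
  "coherent Q \<longleftrightarrow>
     (\<forall>f. Q f \<le> (SUP x. ereal (f x))) \<and>
     (\<forall>f g. Q (\<lambda>x. f x + g x) \<le> Q f + Q g) \<and>
     (\<forall>f. \<forall>c\<ge>0. Q (\<lambda>x. c * f x) = ereal c * Q f)"

definition imprecise_tree :: "('x::finite) tree \<Rightarrow> bool" where
  "imprecise_tree Q \<longleftrightarrow> (\<forall>s. coherent (Q s))"

definition cond_var :: "'x global_upper_exp \<Rightarrow> 'x global_var \<Rightarrow> nat \<Rightarrow> 'x global_var" where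
  "cond_var E f n = (\<lambda>\<omega>. E f (path_prefix \<omega> n))"

definition P1 :: "('x::finite) tree \<Rightarrow> 'x global_upper_exp \<Rightarrow> bool" where
  "P1 Q E \<longleftrightarrow> (\<forall>f s. E (\<lambda>\<omega>. ereal (f (\<omega> (length s)))) s = Q s f)"

definition P2 :: "('x::finite) global_upper_exp \<Rightarrow> bool" where
  "P2 E \<longleftrightarrow> (\<forall>f\<in>V_fin. \<forall>s. E f s = E (\<lambda>\<omega>. f \<omega> * indicator (cylinder s) \<omega>) s)"

definition P3 :: "('x::finite) global_upper_exp \<Rightarrow> bool" where
  "P3 E \<longleftrightarrow> (\<forall>f\<in>V_fin. \<forall>n. cond_var E f n \<le> cond_var E (cond_var E f (n + 1)) n)"

definition P3_eq :: "('x::finite) global_upper_exp \<Rightarrow> bool" where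
  "P3_eq E \<longleftrightarrow> (\<forall>f\<in>V_fin. \<forall>n. cond_var E f n = cond_var E (cond_var E f (n + 1)) n)"

definition P4 :: "('x::finite) global_upper_exp \<Rightarrow> bool" where
  "P4 E \<longleftrightarrow> (\<forall>f g s. f \<le> g \<longrightarrow> E f s \<le> E g s)"

definition P5 :: "('x::finite) global_upper_exp \<Rightarrow> bool" where
  "P5 E \<longleftrightarrow> (\<forall>fs f s. (\<forall>n. fs n \<in> V_fin) \<and> unif_bounded_below fs \<and> ptwise_lim fs f
      \<longrightarrow> limsup (\<lambda>n. E (fs n) s) \<ge> E f s)"

definition P6 :: "('x::finite) global_upper_exp \<Rightarrow> bool" where
  "P6 E \<longleftrightarrow> (\<forall>f\<in>V_blim. \<forall>s. \<exists>fs. (\<forall>n. gamble (fs n) \<and> n_measurable n (fs n)) \<and>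
      unif_bounded_below fs \<and> ptwise_lim fs f \<and> limsup (\<lambda>n. E (fs n) s) \<le> E f s)"

definition P7 :: "('x::finite) global_upper_exp \<Rightarrow> bool" where
  "P7 E \<longleftrightarrow> (\<forall>f s. E f s = Inf {E g s | g. g \<in> V_blim \<and> g \<ge> f})"

definition E_1_5 :: "('x::finite) tree \<Rightarrow> 'x global_upper_exp set" where
  "E_1_5 Q = {E. P1 Q E \<and> P2 E \<and> P3 E \<and> P4 E \<and> P5 E}"

end

theory Submission
  imports Defs
begin

text \<open>
  The axioms P1 and P2 determine \<open>E g s\<close> whenever \<open>g\<close>, inside the cylinder of \<open>s\<close>, depends only on the
  next state: the value is then that of the local model \<open>Q s\<close> (lemma \<open>E_eq_local_model\<close>).  A finitary
  gamble is constant on all sufficiently deep cylinders, so all \<open>E \<in> E_1_5 Q\<close> agree there.  Going back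
  towards the root one step at a time, the law of iterated upper expectations expresses
  \<open>E f s\<close> through the local model at \<open>s\<close> applied to the values \<open>E f (s @ [x])\<close>.  This is an equality under P3\<open>\<^sup>=\<close>
  and only an upper bound under P3, so with monotonicity an \<open>E\<close> satisfying P3\<open>\<^sup>=\<close> dominates every \<open>E'\<close>
  on finitary gambles (lemma \<open>finitary_dominance\<close>).

  The order then spreads in two steps.  For \<open>f \<in> V_blim\<close>, P6 supplies finitary gambles
  converging to \<open>f\<close> along which the upper limit of \<open>E\<close> is at most \<open>E f s\<close>, while by P5 the upper limit
  of \<open>E'\<close> along the same sequence is at least \<open>E' f s\<close>; the finitary case compares the two limits.  For an
  arbitrary \<open>f\<close>, P7 describes \<open>E f s\<close> as an infimum over majorants in \<open>V_blim\<close>, and monotonicity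
  makes \<open>E' f s\<close> a lower bound of that infimum.
\<close>

lemma length_path_prefix [simp]: "length (path_prefix \<omega> n) = n"
  by (simp add: path_prefix_def)

lemma path_prefix_Suc: "path_prefix \<omega> (Suc n) = path_prefix \<omega> n @ [\<omega> n]"
  by (simp add: path_prefix_def)

lemma path_prefix_cylinder: "\<omega> \<in> cylinder s \<Longrightarrow> path_prefix \<omega> (length s) = s"
  by (simp add: cylinder_def)

lemma cylinder_nonempty: obtains \<omega> where "\<omega> \<in> cylinder s"
proof
  show "(\<lambda>i. s ! i) \<in> cylinder s"
    by (simp add: cylinder_def path_prefix_def map_nth)
qed

lemma path_prefix_eq_mono:
  assumes "path_prefix \<omega> n = path_prefix \<omega>' n" and "m \<le> n"
  shows "path_prefix \<omega> m = path_prefix \<omega>' m"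
  using assms by (auto simp: path_prefix_def)

lemma next_state_in_V_fin:
  fixes h :: "'x::finite \<Rightarrow> real"
  shows "(\<lambda>\<omega>. ereal (h (\<omega> k))) \<in> V_fin"
proof -
  have "\<bar>h x\<bar> \<le> Max (range (\<lambda>x. \<bar>h x\<bar>))" for x
    by simp
  then have "gamble (\<lambda>\<omega>. ereal (h (\<omega> k)))"
    unfolding gamble_def by (auto intro!: exI[of _ "Max (range (\<lambda>x. \<bar>h x\<bar>))"])
  moreover have "n_measurable (Suc k) (\<lambda>\<omega>. ereal (h (\<omega> k)))"
    by (auto simp: n_measurable_def path_prefix_Suc)
  ultimately show ?thesis
    by (auto simp: V_fin_def finitary_def)
qed

text \<open>
  By P2 the value at \<open>s\<close> only sees the variable inside the cylinder of \<open>s\<close>, where \<open>g\<close> coincides with a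
  function of the next state; P1 evaluates the latter.
\<close>

lemma E_eq_local_model:
  fixes Q :: "('x::finite) tree"
  assumes "P1 Q E" and "P2 E" and "g \<in> V_fin"
    and eq: "\<And>\<omega>. \<omega> \<in> cylinder s \<Longrightarrow> g \<omega> = ereal (h (\<omega> (length s)))"
  shows "E g s = Q s h"
proof -
  let ?H = "\<lambda>\<omega>. ereal (h (\<omega> (length s)))"
  have "E g s = E (\<lambda>\<omega>. g \<omega> * indicator (cylinder s) \<omega>) s"
    using assms(2,3) by (auto simp: P2_def)
  also have "(\<lambda>\<omega>. g \<omega> * indicator (cylinder s) \<omega>) = (\<lambda>\<omega>. ?H \<omega> * indicator (cylinder s) \<omega>)"
    by (auto simp: eq indicator_def)
  also have "E (\<lambda>\<omega>. ?H \<omega> * indicator (cylinder s) \<omega>) s = E ?H s"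
    using assms(2) next_state_in_V_fin[of h "length s"] unfolding P2_def by metis
  also have "\<dots> = Q s h"
    using assms(1) by (auto simp: P1_def)
  finally show ?thesis .
qed

text \<open>
  The lower bound comes from subadditivity, \<open>0 = Q 0 \<le> Q c + Q (- c)\<close>, since \<open>Q (- c) \<le> - c\<close>.
\<close>

lemma coherent_const_bounds:
  fixes Q :: "('x::finite \<Rightarrow> real) \<Rightarrow> ereal"
  assumes "coherent Q"
  shows "Q (\<lambda>_. c) \<le> ereal c" and "ereal c \<le> Q (\<lambda>_. c)"
proof -
  have upper: "Q (\<lambda>_. a) \<le> ereal a" for a
  proof -
    have "Q (\<lambda>_. a) \<le> (SUP x::'x. ereal a)"
      using assms unfolding coherent_def by blast
    then show ?thesis
      by simp
  qed
  show "Q (\<lambda>_. c) \<le> ereal c"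
    by (rule upper)
  have "Q (\<lambda>x. 0 * (0::real)) = ereal 0 * Q (\<lambda>_. 0)"
    using assms[unfolded coherent_def, THEN conjunct2, THEN conjunct2, rule_format, of 0] by simp
  then have "0 = Q (\<lambda>x. c + - c)"
    by (simp flip: zero_ereal_def)
  also have "\<dots> \<le> Q (\<lambda>_. c) + Q (\<lambda>_. - c)"
    using assms[unfolded coherent_def, THEN conjunct2, THEN conjunct1, rule_format] .
  finally have "0 \<le> Q (\<lambda>_. c) + Q (\<lambda>_. - c)" .
  then show "ereal c \<le> Q (\<lambda>_. c)"
    using upper[of c] upper[of "- c"]
    by (cases "Q (\<lambda>_. c)"; cases "Q (\<lambda>_. - c)") auto
qed

text \<open>
  Conditional upper expectations inherit the bounds of the gamble.  Hence the inner upper expectation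
  in P3 and P3\<open>\<^sup>=\<close> is itself a finitary gamble, to which P2 applies.
\<close>

lemma abs_E_le:
  fixes Q :: "('x::finite) tree"
  assumes "imprecise_tree Q" and "P1 Q E" and "P4 E"
    and bound: "\<And>\<omega>. \<bar>f \<omega>\<bar> \<le> ereal c"
  shows "\<bar>E f s\<bar> \<le> ereal c"
proof -
  have Q: "coherent (Q s)"
    using assms(1) by (simp add: imprecise_tree_def)
  have const: "E (\<lambda>_. ereal a) s = Q s (\<lambda>_. a)" for a
    using assms(2)[unfolded P1_def, rule_format, of "\<lambda>_. a"] .
  have "f \<omega> \<le> ereal c \<and> ereal (- c) \<le> f \<omega>" for \<omega>
    using bound[of \<omega>] by (cases "f \<omega>") auto
  then have "f \<le> (\<lambda>_. ereal c)" and "(\<lambda>_. ereal (- c)) \<le> f"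
    by (simp_all add: le_fun_def)
  then have "E f s \<le> ereal c" and "ereal (- c) \<le> E f s"
    using assms(3) coherent_const_bounds[OF Q] const unfolding P4_def
    by (metis order_trans)+
  then show ?thesis
    by (cases "E f s") auto
qed

lemma cond_var_in_V_fin:
  fixes Q :: "('x::finite) tree"
  assumes "imprecise_tree Q" and "P1 Q E" and "P4 E" and "f \<in> V_fin"
  shows "cond_var E f n \<in> V_fin"
proof -
  obtain c where "\<And>\<omega>. \<bar>f \<omega>\<bar> \<le> ereal c"
    using assms(4) by (auto simp: V_fin_def gamble_def)
  then have "\<bar>E f t\<bar> \<le> ereal c" for t
    using abs_E_le[OF assms(1-3)] by blast
  then have "gamble (cond_var E f n)"
    unfolding gamble_def cond_var_def by blast
  moreover have "n_measurable n (cond_var E f n)"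
    by (simp add: n_measurable_def cond_var_def)
  ultimately show ?thesis
    by (auto simp: V_fin_def finitary_def)
qed

lemma cond_var_at:
  assumes "\<omega> \<in> cylinder s"
  shows "cond_var E f (length s) \<omega> = E f s"
  using assms by (simp add: cond_var_def path_prefix_cylinder)

text \<open>
  Backward induction on the depth of the situation, from the depth at which \<open>f\<close> is decided.  The step
  replaces \<open>E'\<close> by \<open>E\<close> inside the iterated expectation; what remains depends on the next state only, so
  the outer \<open>E'\<close> and the outer \<open>E\<close> both reduce to the same local model.
\<close>

lemma finitary_dominance:
  fixes Q :: "('x::finite) tree"
  assumes Q: "imprecise_tree Q"
    and E: "P1 Q E" "P2 E" "P4 E" "P3_eq E"
    and E': "P1 Q E'" "P2 E'" "P3 E'" "P4 E'"
    and f: "f \<in> V_fin"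
  shows "E' f s \<le> E f s"
proof -
  obtain n where n: "n_measurable n f"
    using f by (auto simp: V_fin_def finitary_def)
  show ?thesis
  proof (induction "n - length s" arbitrary: s)
    case 0
    obtain \<omega>0 where \<omega>0: "\<omega>0 \<in> cylinder s"
      using cylinder_nonempty .
    obtain c where "\<bar>f \<omega>0\<bar> \<le> ereal c"
      using f by (auto simp: V_fin_def gamble_def)
    then obtain r where r: "f \<omega>0 = ereal r"
      by (cases "f \<omega>0") auto
    have "f \<omega> = ereal r" if "\<omega> \<in> cylinder s" for \<omega>
    proof -
      have "path_prefix \<omega> n = path_prefix \<omega>0 n"
        using path_prefix_eq_mono[of \<omega> "length s" \<omega>0 n] that \<omega>0 0
        by (simp add: path_prefix_cylinder)
      then have "f \<omega> = f \<omega>0"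
        using n unfolding n_measurable_def by blast
      with r show ?thesis
        by simp
    qed
    then have "E' f s = Q s (\<lambda>_. r)" and "E f s = Q s (\<lambda>_. r)"
      using E_eq_local_model[OF E'(1,2) f, where h = "\<lambda>_. r"]
        E_eq_local_model[OF E(1,2) f, where h = "\<lambda>_. r"] by simp_all
    then show ?case
      by simp
  next
    case (Suc k)
    let ?g = "cond_var E f (Suc (length s))"
    \<comment> \<open>Local models act on real-valued functions.  The values \<open>E f (s @ [x])\<close> are finite, being those
      of the gamble \<open>?g\<close> on the cylinder of \<open>s\<close>, so nothing is lost by \<open>real_of_ereal\<close>.\<close>
    let ?h = "\<lambda>x. real_of_ereal (E f (s @ [x]))"
    obtain \<omega>0 where \<omega>0: "\<omega>0 \<in> cylinder s"
      using cylinder_nonempty .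
    have g: "?g \<in> V_fin"
      using cond_var_in_V_fin[OF Q E(1,3) f] .
    have g_eq: "?g \<omega> = ereal (?h (\<omega> (length s)))" if "\<omega> \<in> cylinder s" for \<omega>
    proof -
      obtain c where "\<bar>?g \<omega>\<bar> \<le> ereal c"
        using g by (auto simp: V_fin_def gamble_def)
      then have "?g \<omega> = ereal (real_of_ereal (?g \<omega>))"
        by (cases "?g \<omega>") auto
      moreover have "?g \<omega> = E f (s @ [\<omega> (length s)])"
        using that by (simp add: cond_var_def path_prefix_Suc path_prefix_cylinder)
      ultimately show ?thesis
        by simp
    qed
    have "cond_var E' f (Suc (length s)) \<le> ?g"
      unfolding le_fun_def cond_var_def using Suc(2) by (intro allI Suc(1)) simp
    then have mono: "E' (cond_var E' f (Suc (length s))) s \<le> E' ?g s"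
      using E'(4) by (auto simp: P4_def)
    have "cond_var E' f (length s) \<omega>0
        \<le> cond_var E' (cond_var E' f (length s + 1)) (length s) \<omega>0"
      using E'(3) f unfolding P3_def le_fun_def by blast
    then have "E' f s \<le> E' (cond_var E' f (Suc (length s))) s"
      using cond_var_at[OF \<omega>0] by (metis Suc_eq_plus1)
    also note mono
    also have "E' ?g s = Q s ?h"
      using E_eq_local_model[OF E'(1,2) g g_eq] .
    also have "Q s ?h = E ?g s"
      using E_eq_local_model[OF E(1,2) g g_eq] by simp
    also have "\<dots> = E f s"
      using E(4) f cond_var_at[OF \<omega>0] unfolding P3_eq_def by (metis Suc_eq_plus1)
    finally show ?case .
  qed
qed

text \<open>
  The sequence that P6 chooses for \<open>E\<close> also serves for \<open>E'\<close>: P5 holds along every convergent,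
  uniformly bounded below sequence of finitary gambles, however it was chosen.
\<close>

lemma V_blim_dominance:
  assumes "P6 E" and "P5 E'"
    and fin: "\<And>g. g \<in> V_fin \<Longrightarrow> E' g s \<le> E g s"
    and f: "f \<in> V_blim"
  shows "E' f s \<le> E f s"
proof -
  obtain fs where fs: "\<And>n. gamble (fs n) \<and> n_measurable n (fs n)"
    and lim: "unif_bounded_below fs" "ptwise_lim fs f"
    and le: "limsup (\<lambda>n. E (fs n) s) \<le> E f s"
    using assms(1) f unfolding P6_def by metis
  have V: "fs n \<in> V_fin" for n
    using fs by (auto simp: V_fin_def finitary_def)
  have "E' f s \<le> limsup (\<lambda>n. E' (fs n) s)"
    using assms(2) V lim unfolding P5_def by blast
  also have "\<dots> \<le> limsup (\<lambda>n. E (fs n) s)"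
    by (intro Limsup_mono always_eventually allI fin V)
  also note le
  finally show ?thesis .
qed

theorem theorem4:
  fixes Q :: "('x::finite) tree" and E :: "'x global_upper_exp"
  assumes "imprecise_tree Q"
    and "E \<in> E_1_5 Q"
    and "P3_eq E" and "P6 E" and "P7 E"
  shows "\<forall>E' \<in> E_1_5 Q. \<forall>f s. E f s \<ge> E' f s"
proof (intro ballI allI)
  fix E' f s
  assume "E' \<in> E_1_5 Q"
  then have E': "P1 Q E'" "P2 E'" "P3 E'" "P4 E'" "P5 E'"
    by (simp_all add: E_1_5_def)
  have E: "P1 Q E" "P2 E" "P4 E"
    using assms(2) by (simp_all add: E_1_5_def)
  have fin: "E' g s \<le> E g s" if "g \<in> V_fin" for g
    using finitary_dominance[OF assms(1) E assms(3) E'(1-4) that] .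
  have "E' f s \<le> E g s" if "g \<in> V_blim" and "f \<le> g" for g
  proof -
    have "E' f s \<le> E' g s"
      using E'(4) that(2) by (simp add: P4_def)
    also have "\<dots> \<le> E g s"
      using V_blim_dominance[OF assms(4) E'(5) fin that(1)] .
    finally show ?thesis .
  qed
  then have "E' f s \<le> Inf {E g s | g. g \<in> V_blim \<and> g \<ge> f}"
    by (intro Inf_greatest) blast
  also have "\<dots> = E f s"
    using assms(5)[unfolded P7_def, rule_format, of f s] by (rule sym)
  finally show "E' f s \<le> E f s" .
qed

end
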